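(* Let $d\ge 0$ be an integer, let $a_0,\dots,a_d$ be positive integers, $m_0,\dots,m_d$ nonnegative integers, and $z_0,\dots,z_d\in\mathbb{C}$. Suppose that for all distinct $i,j\in\{0,\dots,d\}$ and all $m,n\in\mathbb{Z}$, \[ \frac{m+z_i}{a_i}-\frac{n+z_j}{a_j}\notin\mathbb{Z}. \] Then \[ \sum_{n=0}^{d} (-1)^{m_n}\, m_n!\!\!\sum_{\substack{(l_j)_{j\neq n},\ l_j\ge 0\\ \sum_{j\ne n} l_j=m_n}}\ \left(\prod_{j\neq n}\frac{a_j^{l_j}}{l_j!}\right)\, \mathfrak{c}\left(\begin{array}{c|ccccc} a_n & a_0 & \cdots & \widehat{a_n} & \cdots & a_d\\ m_n & m_0+l_0 & \cdots & \widehat{m_n+l_n} & \cdots & m_d+l_d\\ z_n & z_0 & \cdots & \widehat{z_n} & \cdots & z_d\end{array}\right) =\begin{cases}(-1)^{d/2} & \text{if } m_0=\dots=m_d=0 \text{ and } d \text{ is even},\\ 0 & \text{otherwise,}\end{cases} \] where the inner sum runs over all tuples $(l_0,\dots,\widehat{l_n},\dots,l_d)$ of nonnegative integers (indexed by $j\in\{0,\dots,d\}\setminus\{n\}$) with sum $m_n$, and a hat means the entry is omitted (the remaining columns keep their order by increasing index $j$).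
   Context: For positive integers $b_0,\dots,b_e$, nonnegative integers $\mu_0,\dots,\mu_e$ and complex numbers $w_0,\dots,w_e$, the Dedekind cotangent sum is \[ \mathfrak{c}\left(\begin{array}{c|ccc} b_0 & b_1 & \cdots & b_e\\ \mu_0 & \mu_1 & \cdots & \mu_e\\ w_0 & w_1 & \cdots & w_e\end{array}\right) := \frac{1}{b_0^{\mu_0+1}}\sum_{k \bmod b_0}\ \prod_{j=1}^{e}\cot^{(\mu_j)}\pi\left(b_j\frac{k+w_0}{b_0}-w_j\right), \] where $\cot^{(\mu)}$ denotes the $\mu$-th derivative of the cotangent function, and the sum is taken over those residues $k$ modulo $b_0$ for which the summand is not singular. *)

theory Defs
  imports "HOL-Complex_Analysis.Complex_Analysis"
begin

(* A column (b, mu, w) of the array of the cotangent sum. *)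
type_synonym cot_column = "nat \<times> nat \<times> complex"

(* cot^(mu) is the mu-th complex derivative of cot, evaluated at pi * x; all factors are
   meromorphic with poles exactly at the integers x. *)
definition cot_factor :: "nat \<Rightarrow> complex \<Rightarrow> complex" where
  "cot_factor \<mu> x = (deriv ^^ \<mu>) cot (of_real pi * x)"

(* The first column is (b0, mu0, w0), the list holds columns 1, ..., e.  Replacing k by k + b0
   shifts the j-th argument by the integer b_j, so {0..<b0} may stand for any system of residues
   mod b0.  A summand is singular if one of its factors has a pole. *)
fun dedekind_cot_sum :: "cot_column \<Rightarrow> cot_column list \<Rightarrow> complex" where
  "dedekind_cot_sum (b0, \<mu>0, w0) cols =
     1 / of_nat b0 ^ (\<mu>0 + 1) *
     (\<Sum>k \<in> {k \<in> {0..<b0}. \<forall>(b, \<mu>, w) \<in> set cols.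
                  of_nat b * ((of_nat k + w0) / of_nat b0) - w \<notin> \<int>}.
        \<Prod>(b, \<mu>, w) \<leftarrow> cols. cot_factor \<mu> (of_nat b * ((of_nat k + w0) / of_nat b0) - w))"

definition tuples_with_sum :: "nat set \<Rightarrow> nat \<Rightarrow> (nat \<Rightarrow> nat) set" where
  "tuples_with_sum J s = {l \<in> J \<rightarrow>\<^sub>E UNIV. (\<Sum>j\<in>J. l j) = s}"

lemma finite_tuples_with_sum:
  assumes "finite J"
  shows "finite (tuples_with_sum J s)"
proof (rule finite_subset)
  show "tuples_with_sum J s \<subseteq> J \<rightarrow>\<^sub>E {..s}"
    using assms by (auto simp: tuples_with_sum_def intro!: PiE_I intro: member_le_sum dest: PiE_arb)
  show "finite (J \<rightarrow>\<^sub>E {..s})"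
    using assms by (intro finite_PiE) auto
qed

end

theory Submission
  imports Defs "HOL-Real_Asymp.Real_Asymp"
begin

text \<open>
  The function \<open>f w = (\<Prod>j\<le>d. cot\<^bsup>(m j)\<^esup> (\<pi> (a j w - z j)))\<close> has period 1 and, by hypothesis, its factors have
  pairwise disjoint sets of poles.  At a pole of the \<open>n\<close>-th factor the residue involves the
  \<open>m n\<close>-th derivative of the remaining product, so the Leibniz rule turns \<open>\<pi>\<close> times the sum of these
  residues over a period strip into the \<open>n\<close>-th summand of the theorem.  The sum of all residues in
  the strip is \<open>1/(2\<pi>\<i>)\<close> times the difference of the limits of \<open>f\<close> at \<open>-\<i>\<infinity>\<close> and \<open>+\<i>\<infinity>\<close>; these are
  \<open>\<i>\<^bsup>d+1\<^esup>\<close> and \<open>(-\<i>)\<^bsup>d+1\<^esup>\<close> if no factor is differentiated, and \<open>0\<close> otherwise.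
\<close>

section \<open>Leibniz rule for finite products\<close>

text \<open>Splitting off the value \<open>i\<close> at the new index \<open>j\<close> leaves a
  tuple on \<open>J\<close> with sum \<open>n - i\<close>. This is the recursion behind the
  induction in \<open>higher_deriv_prod\<close>.\<close>

lemma sum_tuples_with_sum_insert:
  fixes F :: "(nat \<Rightarrow> nat) \<Rightarrow> 'a::comm_monoid_add"
  assumes "finite J" "j \<notin> J"
  shows "(\<Sum>l\<in>tuples_with_sum (insert j J) n. F l) =
           (\<Sum>i=0..n. \<Sum>l\<in>tuples_with_sum J (n - i). F (l(j := i)))"
proof -
  have "(\<Sum>i=0..n. \<Sum>l\<in>tuples_with_sum J (n - i). F (l(j := i))) =
        (\<Sum>(i, l)\<in>(SIGMA i:{0..n}. tuples_with_sum J (n - i)). F (l(j := i)))"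
    by (rule sum.Sigma) (auto simp: finite_tuples_with_sum assms)
  also have "\<dots> = (\<Sum>l\<in>tuples_with_sum (insert j J) n. F l)"
  \<comment> \<open>Tuples on \<open>J\<close> are extensional functions, so restricting a tuple to
    \<open>J\<close> means resetting its value at \<open>j\<close> to
    \<open>undefined\<close>.\<close>
  proof (rule sum.reindex_bij_witness[where i = "\<lambda>l. (l j, l(j := undefined))"
        and j = "\<lambda>(i, l). l(j := i)"], goal_cases)
    case (1 x) then show ?case using assms
      by (auto simp: tuples_with_sum_def PiE_def extensional_def)
  next
    case (2 x) then show ?case using assms
      by (auto simp: tuples_with_sum_def PiE_def extensional_def cong: sum.cong_simp)
         (subst sum.cong[OF refl, where h = "snd x"]; auto)
  next
    case (3 l) then show ?case by simp
  next
    case (4 l)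
    then have "(\<Sum>i\<in>J. (l(j := undefined)) i) = (\<Sum>i\<in>J. l i)"
      using assms by (intro sum.cong) auto
    with 4 show ?case using assms
      by (auto simp: tuples_with_sum_def PiE_def extensional_def)
  next
    case (5 x) then show ?case by auto
  qed
  finally show ?thesis ..
qed

text \<open>Induction on \<open>J\<close> with the binomial Leibniz rule for two factors. Dividing
  each derivative by its factorial absorbs the multinomial coefficients.\<close>

lemma higher_deriv_prod:
  fixes f :: "nat \<Rightarrow> complex \<Rightarrow> complex"
  assumes "finite J" "\<And>j. j \<in> J \<Longrightarrow> f j analytic_on {p}"
  shows "(deriv ^^ n) (\<lambda>z. \<Prod>j\<in>J. f j z) p =
           fact n * (\<Sum>l\<in>tuples_with_sum J n. \<Prod>j\<in>J. (deriv ^^ l j) (f j) p / fact (l j))"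
  using assms
proof (induction J arbitrary: n rule: finite_induct)
  case empty
  then show ?case
    by (cases n) (auto simp: tuples_with_sum_def higher_deriv_const)
next
  case (insert j J)
  let ?D = "\<lambda>i l. (deriv ^^ l) (f i) p / fact l"
  have "(deriv ^^ n) (\<lambda>z. \<Prod>i\<in>insert j J. f i z) p =
        (deriv ^^ n) (\<lambda>z. f j z * (\<Prod>i\<in>J. f i z)) p"
    using insert by simp
  also have "\<dots> = (\<Sum>i=0..n. of_nat (n choose i) * (deriv ^^ i) (f j) p *
                      (deriv ^^ (n - i)) (\<lambda>z. \<Prod>i\<in>J. f i z) p)"
    using insert by (intro higher_deriv_mult_at analytic_on_prod) auto
  \<comment> \<open>The factor \<open>fact (n - i)\<close> from the induction hypothesis cancels
    against the denominator of the binomial coefficient.\<close>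
  also have "\<dots> = (\<Sum>i=0..n. fact n * (?D j i *
                      (\<Sum>l\<in>tuples_with_sum J (n - i). \<Prod>k\<in>J. ?D k (l k))))"
    using insert by (intro sum.cong) (auto simp: binomial_fact)
  also have "\<dots> = fact n * (\<Sum>i=0..n. \<Sum>l\<in>tuples_with_sum J (n - i). ?D j i * (\<Prod>k\<in>J. ?D k (l k)))"
    by (simp add: sum_distrib_left)
  also have "(\<Sum>i=0..n. \<Sum>l\<in>tuples_with_sum J (n - i). ?D j i * (\<Prod>k\<in>J. ?D k (l k))) =
      (\<Sum>i=0..n. \<Sum>l\<in>tuples_with_sum J (n - i). \<Prod>k\<in>insert j J. ?D k ((l(j := i)) k))"
  proof (intro sum.cong refl)
    fix i l
    have "(\<Prod>k\<in>J. ?D k (l k)) = (\<Prod>k\<in>J. ?D k ((l(j := i)) k))"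
      using insert by (intro prod.cong) auto
    then show "?D j i * (\<Prod>k\<in>J. ?D k (l k)) = (\<Prod>k\<in>insert j J. ?D k ((l(j := i)) k))"
      using insert by simp
  qed
  finally show ?case
    using insert by (subst sum_tuples_with_sum_insert) auto
qed

section \<open>Periodicity, analyticity and derivatives of the cotangent factors\<close>

lemma cot_holomorphic: "cot holomorphic_on {z::complex. sin z \<noteq> 0}"
  unfolding cot_def by (intro holomorphic_intros) auto

lemma open_sin_nonzero: "open {z::complex. sin z \<noteq> 0}"
  by (intro open_Collect_neq continuous_intros)

lemma sin_of_real_pi_mult_eq_0_iff: "sin (of_real pi * x) = 0 \<longleftrightarrow> (x::complex) \<in> \<int>"
proof
  assume "sin (of_real pi * x) = 0"
  then obtain n :: int where "of_real pi * x = of_real (of_int n * pi)"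
    using Complex_Transcendental.sin_eq_0 by blast
  then have "of_real pi * x = of_real pi * of_int n"
    by (simp add: mult.commute)
  then have "x = of_int n"
    by simp
  then show "x \<in> \<int>" by simp
qed (auto simp: Complex_Transcendental.sin_eq_0 elim!: Ints_cases)

lemma cot_plus_pi_int: "cot (w + of_real pi * of_int k) = cot (w::complex)"
proof -
  have "sin (of_real pi * of_int k :: complex) = 0"
    by (simp add: sin_of_real_pi_mult_eq_0_iff)
  moreover from this have "cos (of_real pi * of_int k :: complex) \<noteq> 0"
    using sin_cos_squared_add[of "of_real pi * of_int k :: complex"] by auto
  ultimately show ?thesis
    by (simp add: cot_def sin_add cos_add)
qed

lemma cot_factor_plus_int:
  assumes "k \<in> \<int>"
  shows "cot_factor \<mu> (x + k) = cot_factor \<mu> x"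
proof -
  obtain n where k: "k = of_int n" using assms by (auto elim: Ints_cases)
  have "(deriv ^^ \<mu>) cot (of_real pi * x + of_real pi * k) = (deriv ^^ \<mu>) cot (of_real pi * x)"
  proof -
    have "cot (of_real pi * x + of_real pi * k + y) = cot (of_real pi * x + y)" for y
      using cot_plus_pi_int[of "of_real pi * x + y" n] by (simp add: k add_ac)
    \<comment> \<open>Moving the base point to 0 turns both sides into derivatives at 0 of
      translates of \<open>cot\<close>, and these translates are the same function.\<close>
    then show ?thesis
      by (subst (1 2) higher_deriv_shift_0) (simp add: o_def)
  qed
  then show ?thesis
    by (simp add: cot_factor_def distrib_left)
qed

lemma higher_deriv_cot_holomorphic: "(deriv ^^ \<mu>) cot holomorphic_on {z::complex. sin z \<noteq> 0}"
  by (intro holomorphic_higher_deriv cot_holomorphic open_sin_nonzero)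

lemma cot_factor_analytic:
  assumes "\<alpha> * p - \<beta> \<notin> \<int>"
  shows "(\<lambda>z. cot_factor \<mu> (\<alpha> * z - \<beta>)) analytic_on {p}"
proof -
  have "(deriv ^^ \<mu>) cot analytic_on {of_real pi * (\<alpha> * p - \<beta>)}"
    by (rule holomorphic_on_imp_analytic_at[OF higher_deriv_cot_holomorphic open_sin_nonzero])
       (simp add: assms sin_of_real_pi_mult_eq_0_iff del: sin_zero)
  then have "((deriv ^^ \<mu>) cot \<circ> (\<lambda>z. of_real pi * (\<alpha> * z - \<beta>))) analytic_on {p}"
    by (intro analytic_on_compose[of "\<lambda>z. of_real pi * (\<alpha> * z - \<beta>)"])
       (auto intro!: analytic_intros)
  then show ?thesis
    by (simp add: cot_factor_def[abs_def] o_def)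
qed

text \<open>The chain rule for an affine argument. The power of \<alpha> produced here becomes the
  weight \<open>a j ^ l j\<close> of the theorem.\<close>

lemma higher_deriv_cot_factor:
  assumes "\<alpha> * p - \<beta> \<notin> \<int>"
  shows "(deriv ^^ l) (\<lambda>z. cot_factor \<mu> (\<alpha> * z - \<beta>)) p =
           (of_real pi * \<alpha>) ^ l * cot_factor (\<mu> + l) (\<alpha> * p - \<beta>)"
proof -
  let ?T = "{z::complex. sin z \<noteq> 0}"
  let ?S = "(\<lambda>z. (of_real pi * \<alpha>) * z + (- of_real pi * \<beta>)) -` ?T"
  have "open ?S"
    by (intro open_vimage open_sin_nonzero continuous_intros)
  moreover have "p \<in> ?S"
    using assms sin_of_real_pi_mult_eq_0_iff[of "\<alpha> * p - \<beta>"] by (simp add: algebra_simps)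
  ultimately have "(deriv ^^ l) (\<lambda>z. (deriv ^^ \<mu>) cot ((of_real pi * \<alpha>) * z + (- of_real pi * \<beta>))) p =
      (of_real pi * \<alpha>) ^ l * (deriv ^^ l) ((deriv ^^ \<mu>) cot) ((of_real pi * \<alpha>) * p + (- of_real pi * \<beta>))"
    by (intro higher_deriv_compose_linear'[OF higher_deriv_cot_holomorphic _ open_sin_nonzero]) auto
  moreover have "(deriv ^^ l) ((deriv ^^ \<mu>) cot) = (deriv ^^ (\<mu> + l)) (cot :: complex \<Rightarrow> complex)"
    by (simp add: add.commute[of \<mu>] funpow_add)
  ultimately show ?thesis
    by (simp add: cot_factor_def[abs_def] right_diff_distrib mult.assoc)
qed

section \<open>Exponential approach of the cotangent to its limits far from the real axis\<close>

text \<open>The sign \<sigma> selects the upper (1) or lower (-1) half-plane, so that one proof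
  serves both. By Euler's formula \<open>cot z + \<sigma> * \<i>\<close> equals
  \<open>exp (\<sigma> * \<i> * z) / sin z\<close>, whose numerator has modulus
  \<open>exp (- (\<sigma> * Im z))\<close>, while the denominator is bounded away from 0.\<close>

lemma norm_cot_plus_i_le:
  assumes \<sigma>: "\<sigma> \<in> {1, -1::real}" and y: "\<sigma> * Im z \<ge> 1"
  shows "sin z \<noteq> 0" and "norm (cot z + \<sigma> * \<i>) \<le> 4 * exp (- (\<sigma> * Im z))"
proof -
  define E where "E = exp (\<sigma> * Im z)"
  have "1 + \<sigma> * Im z \<le> E"
    unfolding E_def by (rule exp_ge_add_one_self)
  with y have E: "E \<ge> 2" by simp
  have inv: "exp (- (\<sigma> * Im z)) = inverse E"
    by (simp add: E_def exp_minus)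
  have "E - inverse E \<le> norm (exp (- (\<sigma> * \<i> * z))) - norm (exp (\<sigma> * \<i> * z))"
    unfolding E_def norm_exp_eq_Re by (simp add: exp_minus)
  also have "\<dots> \<le> norm (exp (- (\<sigma> * \<i> * z)) - exp (\<sigma> * \<i> * z))"
    by (rule norm_triangle_ineq2)
  also have "\<dots> = 2 * norm (sin z)"
    using \<sigma> by (auto simp: sin_exp_eq norm_divide norm_mult norm_minus_commute)
  finally have "E - inverse E \<le> 2 * norm (sin z)" .
  moreover have "inverse E \<le> 1 / 2"
    using le_imp_inverse_le[OF E] by (simp add: inverse_eq_divide)
  \<comment> \<open>From \<open>E \<ge> 2\<close> even 3/4 would follow; 1/4 gives the constant 4 of
    the claim.\<close>
  ultimately have sin: "norm (sin z) \<ge> 1 / 4"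
    using E by linarith
  then show nz: "sin z \<noteq> 0" by auto
  have "cos z + \<sigma> * \<i> * sin z = exp (\<sigma> * \<i> * z)"
    using \<sigma> exp_Euler[of z] exp_Euler[of "- z"] by auto
  moreover have "cot z + \<sigma> * \<i> = (cos z + \<sigma> * \<i> * sin z) / sin z"
    using nz by (simp add: cot_def field_simps)
  ultimately have "norm (cot z + \<sigma> * \<i>) = inverse E / norm (sin z)"
    by (simp add: norm_divide norm_exp_eq_Re inv[symmetric])
  also have "\<dots> \<le> inverse E / (1 / 4)"
    using sin E by (intro divide_left_mono) auto
  finally show "norm (cot z + \<sigma> * \<i>) \<le> 4 * exp (- (\<sigma> * Im z))"
    by (simp add: inv)
qed

text \<open>Cauchy's estimate on the unit disc around \<open>z\<close>, applied to the distance of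
  \<open>cot\<close> from its limit. Inside the disc the imaginary part drops by at most 1, which
  explains the bound 2 in the hypothesis and the 1 in the exponent. The estimate concerns positive
  orders only, so \<mu> = 0 is separate.\<close>

lemma norm_higher_deriv_cot_le:
  assumes \<sigma>: "\<sigma> \<in> {1, -1::real}" and y: "\<sigma> * Im z \<ge> 2"
  shows "norm ((deriv ^^ \<mu>) cot z - (if \<mu> = 0 then - \<sigma> * \<i> else 0))
           \<le> fact \<mu> * 5 * exp (1 - \<sigma> * Im z)"
proof (cases "\<mu> = 0")
  case True
  have "norm (cot z + \<sigma> * \<i>) \<le> 4 * exp (- (\<sigma> * Im z))"
    using y by (intro norm_cot_plus_i_le[OF \<sigma>]) auto
  also have "\<dots> \<le> 5 * exp (1 - \<sigma> * Im z)"
    by (intro mult_mono) auto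
  finally show ?thesis
    using True by simp
next
  case False
  have Im: "\<sigma> * Im w \<ge> \<sigma> * Im z - 1" if "w \<in> cball z 1" for w
  proof -
    have "\<bar>Im z - Im w\<bar> \<le> 1"
      using that abs_Im_le_cmod[of "z - w"] by (simp add: dist_norm)
    with \<sigma> show ?thesis by auto
  qed
  have "cball z 1 \<subseteq> {w. sin w \<noteq> 0}"
    using Im norm_cot_plus_i_le(1)[OF \<sigma>] y by force
  then have holo: "cot holomorphic_on cball z 1"
    by (rule holomorphic_on_subset[OF cot_holomorphic])
  have "norm ((deriv ^^ \<mu>) cot z) \<le> fact \<mu> * (5 * exp (1 - \<sigma> * Im z)) / 1 ^ \<mu>"
  proof (rule Cauchy_higher_deriv_bound[where y = "- \<sigma> * \<i>"])
    show "cot holomorphic_on ball z 1"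
      using holo ball_subset_cball by (rule holomorphic_on_subset)
    fix w assume "w \<in> ball z 1"
    then have w: "\<sigma> * Im w \<ge> \<sigma> * Im z - 1"
      using Im by simp
    have "norm (cot w + \<sigma> * \<i>) \<le> 4 * exp (- (\<sigma> * Im w))"
      using w y by (intro norm_cot_plus_i_le[OF \<sigma>]) auto
    also have "\<dots> \<le> 4 * exp (1 - \<sigma> * Im z)"
      using w by simp
    \<comment> \<open>The constant grows from 4 to 5 because the values must lie in an open
      ball.\<close>
    also have "\<dots> < 5 * exp (1 - \<sigma> * Im z)"
      by simp
    finally show "cot w \<in> ball (- \<sigma> * \<i>) (5 * exp (1 - \<sigma> * Im z))"
      by (simp add: dist_norm norm_minus_commute algebra_simps)
  qed (use False holo holomorphic_on_imp_continuous_on in auto)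
  with False show ?thesis by simp
qed

text \<open>The filter \<open>filtercomap (\<lambda>z. \<sigma> * Im z) at_top\<close> lets the
  imaginary part tend to \<sigma> times infinity without restricting the real part. Convergence
  along it is therefore uniform on horizontal lines, as the contour integrals require.\<close>

lemma tendsto_cot_factor:
  assumes \<sigma>: "\<sigma> \<in> {1, -1::real}"
  shows "(cot_factor \<mu> \<longlongrightarrow> (if \<mu> = 0 then - \<sigma> * \<i> else 0)) (filtercomap (\<lambda>z. \<sigma> * Im z) at_top)"
    (is "(_ \<longlongrightarrow> ?L) ?F")
proof -
  have top: "filterlim (\<lambda>z. \<sigma> * Im z) at_top ?F"
    by (rule filterlim_filtercomap)
  have "((\<lambda>y::real. fact \<mu> * 5 * exp (1 - pi * y)) \<longlongrightarrow> fact \<mu> * 5 * 0) at_top"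
    by (intro tendsto_intros filterlim_compose[OF exp_at_bot])
       (real_asymp)
  then have "((\<lambda>z. fact \<mu> * 5 * exp (1 - pi * (\<sigma> * Im z))) \<longlongrightarrow> 0) ?F"
    using filterlim_compose[OF _ top] by force
  moreover have "eventually (\<lambda>z. norm (cot_factor \<mu> z - ?L) \<le> fact \<mu> * 5 * exp (1 - pi * (\<sigma> * Im z))) ?F"
  proof (rule eventually_mono[OF filterlim_at_top_dense[THEN iffD1, OF top, rule_format, of 1]])
    fix z assume "1 < \<sigma> * Im z"
    then have "2 * 1 \<le> pi * (\<sigma> * Im z)"
      using pi_ge_two by (intro mult_mono) auto
    then have "2 \<le> \<sigma> * Im (of_real pi * z)"
      by (simp add: mult_ac)
    from norm_higher_deriv_cot_le[OF \<sigma> this, of \<mu>]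
    show "norm (cot_factor \<mu> z - ?L) \<le> fact \<mu> * 5 * exp (1 - pi * (\<sigma> * Im z))"
      by (simp add: cot_factor_def mult_ac)
  qed
  ultimately have "((\<lambda>z. cot_factor \<mu> z - ?L) \<longlongrightarrow> 0) ?F"
    by (rule Lim_null_comparison[rotated])
  then show ?thesis
    by (simp add: LIM_zero_iff)
qed

section \<open>Principal parts and residues\<close>

text \<open>Two removable singularities. \<open>S\<close> extends \<open>sin w / w\<close> and has
  no zero for \<open>norm w < pi\<close>, so \<open>N = cos / S\<close> is a holomorphic extension
  of \<open>w * cot w\<close> with \<open>N 0 = 1\<close>. Then \<open>A\<close> extends the
  difference quotient \<open>(N w - 1) / w\<close>.\<close>

lemma cot_eq_inverse_plus_holomorphic:
  obtains A where "A holomorphic_on ball 0 pi" "\<And>w. w \<in> ball 0 pi - {0} \<Longrightarrow> cot w = inverse w + A w"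
proof -
  define S where "S = (\<lambda>w::complex. if w = 0 then deriv sin 0 else (sin w - sin 0) / (w - 0))"
  have S_holo: "S holomorphic_on ball 0 pi"
    unfolding S_def by (intro pole_lemma_open holomorphic_on_sin open_ball)
  have S0: "S 0 = 1"
    by (simp add: S_def DERIV_imp_deriv[OF DERIV_sin])
  have S_nz: "S w \<noteq> 0" if "w \<in> ball 0 pi" for w
  proof (cases "w = 0")
    case False
    have "sin w \<noteq> 0"
    proof
      assume "sin w = 0"
      then obtain n :: int where n: "w = of_real (of_int n * pi)"
        using Complex_Transcendental.sin_eq_0 by blast
      with that have "\<bar>real_of_int n\<bar> * pi < 1 * pi"
        by (simp add: norm_mult abs_mult)
      then have "\<bar>n\<bar> < 1"
        using mult_less_cancel_right_pos pi_gt_zero by fastforce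
      with n False show False by simp
    qed
    with False show ?thesis by (simp add: S_def)
  qed (simp add: S0)
  define N where "N = (\<lambda>w. cos w / S w)"
  have N_holo: "N holomorphic_on ball 0 pi"
    unfolding N_def using S_nz by (intro holomorphic_intros S_holo) auto
  define A where "A = (\<lambda>w. if w = 0 then deriv N 0 else (N w - N 0) / (w - 0))"
  show ?thesis
  proof
    show "A holomorphic_on ball 0 pi"
      unfolding A_def by (intro pole_lemma_open N_holo open_ball)
    fix w :: complex assume w: "w \<in> ball 0 pi - {0}"
    then show "cot w = inverse w + A w"
      using S_nz[of w] by (simp add: A_def N_def S0 cot_def field_simps) (simp add: S_def)
  qed
qed

lemma higher_deriv_inverse:
  assumes "w \<noteq> 0"
  shows "(deriv ^^ n) inverse w = (-1) ^ n * fact n * inverse (w::complex) ^ Suc n"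
  using assms
proof (induction n arbitrary: w)
  case (Suc n)
  have "deriv ((deriv ^^ n) inverse) w = deriv (\<lambda>w. (-1) ^ n * fact n * inverse w ^ Suc n) w"
    by (rule deriv_cong_ev)
       (use Suc in \<open>auto intro!: eventually_mono[OF t1_space_nhds[of w 0]]\<close>)
  also have "\<dots> = (-1) ^ n * fact n * ((1 + of_nat n) * (- (inverse w ^ Suc (Suc 0)) * inverse w ^ n))"
    using DERIV_inverse[OF Suc.prems, of UNIV]
    by (intro DERIV_imp_deriv DERIV_cmult DERIV_power_Suc) simp
  finally show ?case
    by (simp add: algebra_simps)
qed auto

text \<open>Differentiating \<open>cot w = inverse w + A w\<close> \<mu> times leaves a single polar
  term, of order \<mu> + 1. The radius is 1 because the argument is scaled by
  \<open>pi\<close>.\<close>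

lemma cot_factor_eq_pole_plus_holomorphic:
  obtains A where "A holomorphic_on ball 0 1"
    "\<And>x. x \<in> ball 0 1 - {0} \<Longrightarrow> cot_factor \<mu> x = (-1) ^ \<mu> * fact \<mu> / (of_real pi * x) ^ Suc \<mu> + A x"
proof -
  obtain A where A: "A holomorphic_on ball 0 pi" "\<And>w. w \<in> ball 0 pi - {0} \<Longrightarrow> cot w = inverse w + A w"
    using cot_eq_inverse_plus_holomorphic by blast
  show ?thesis
  proof
    have mem: "of_real pi * x \<in> ball 0 pi" if "x \<in> ball 0 1" for x :: complex
      using that by (simp add: norm_mult)
    have "(deriv ^^ \<mu>) A \<circ> (\<lambda>x. of_real pi * x) holomorphic_on ball 0 1"
      by (rule holomorphic_on_compose_gen[where t = "ball 0 pi"])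
         (use mem in \<open>auto intro!: holomorphic_intros A\<close>)
    then show "(\<lambda>x. (deriv ^^ \<mu>) A (of_real pi * x)) holomorphic_on ball 0 1"
      by (simp add: o_def)
    fix x :: complex assume x: "x \<in> ball 0 1 - {0}"
    let ?B = "ball 0 pi - {0::complex}"
    let ?w = "of_real pi * x"
    have w: "?w \<in> ?B" using mem x by auto
    have op: "open ?B" by auto
    have A': "A holomorphic_on ?B"
      by (rule holomorphic_on_subset[OF A(1)]) auto
    have "(deriv ^^ \<mu>) cot ?w = (deriv ^^ \<mu>) (\<lambda>w. inverse w + A w) ?w"
    proof (rule higher_deriv_transform_within_open[OF _ _ op w A(2)])
      show sum: "(\<lambda>w. inverse w + A w) holomorphic_on ?B"
        by (intro holomorphic_intros A') auto
      then show "cot holomorphic_on ?B"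
        by (rule holomorphic_transform) (use A(2) in auto)
    qed
    also have "\<dots> = (deriv ^^ \<mu>) inverse ?w + (deriv ^^ \<mu>) A ?w"
      by (rule higher_deriv_add[OF _ A' op w]) (intro holomorphic_intros, auto)
    finally show "cot_factor \<mu> x = (-1) ^ \<mu> * fact \<mu> / ?w ^ Suc \<mu> + (deriv ^^ \<mu>) A ?w"
      using x by (simp add: cot_factor_def higher_deriv_inverse divide_inverse power_inverse power_mult_distrib del: power_Suc)
  qed
qed

text \<open>By periodicity the integer \<open>\<alpha> * p - \<beta>\<close> can be replaced by 0.
  Near \<open>p\<close> the factor is then a multiple of \<open>1 / (z - p) ^ Suc \<mu>\<close> plus
  a holomorphic function, and the residue picks out the Taylor coefficient of \<open>G\<close> of
  order \<mu>.\<close>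

lemma residue_cot_factor_mult:
  assumes \<alpha>: "\<alpha> \<noteq> 0" and p: "\<alpha> * p - \<beta> \<in> \<int>" and G: "G analytic_on {p}"
  shows "residue (\<lambda>z. cot_factor \<mu> (\<alpha> * z - \<beta>) * G z) p =
           (-1) ^ \<mu> / (of_real pi * \<alpha>) ^ Suc \<mu> * (deriv ^^ \<mu>) G p"
proof -
  obtain A where A: "A holomorphic_on ball 0 1"
    "\<And>x. x \<in> ball 0 1 - {0} \<Longrightarrow> cot_factor \<mu> x = (-1) ^ \<mu> * fact \<mu> / (of_real pi * x) ^ Suc \<mu> + A x"
    using cot_factor_eq_pole_plus_holomorphic by blast
  obtain r where r: "r > 0" "G holomorphic_on ball p r"
    using G by (auto simp: analytic_on_def)
  \<comment> \<open>The radius keeps \<open>\<alpha> * (z - p)\<close> in the unit disc, where the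
    expansion of \<open>cot_factor\<close> holds.\<close>
  define U where "U = ball p (min r (1 / norm \<alpha>))"
  have U: "open U" "p \<in> U" "U \<subseteq> ball p r"
    using r \<alpha> by (auto simp: U_def)
  have mem: "\<alpha> * (z - p) \<in> ball 0 1" if "z \<in> U" for z
    using that \<alpha> by (simp add: U_def dist_norm norm_minus_commute norm_mult pos_less_divide_eq mult.commute)
  have G_holo: "G holomorphic_on U"
    using r(2) U(3) by (rule holomorphic_on_subset)
  have "A \<circ> (\<lambda>z. \<alpha> * (z - p)) holomorphic_on U"
    by (rule holomorphic_on_compose_gen[where t = "ball 0 1"])
       (use mem in \<open>auto intro!: holomorphic_intros A\<close>)
  then have AG: "(\<lambda>z. A (\<alpha> * (z - p)) * G z) holomorphic_on U"
    by (intro holomorphic_on_mult G_holo) (simp add: o_def)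
  let ?c = "(-1) ^ \<mu> * fact \<mu> / (of_real pi * \<alpha>) ^ Suc \<mu>"
  have quot: "(\<lambda>z. G z / (z - p) ^ Suc \<mu>) holomorphic_on U - {p}"
    by (intro holomorphic_intros holomorphic_on_subset[OF G_holo]) auto
  have "residue (\<lambda>z. cot_factor \<mu> (\<alpha> * z - \<beta>) * G z) p =
        residue (\<lambda>z. ?c * (G z / (z - p) ^ Suc \<mu>) + A (\<alpha> * (z - p)) * G z) p"
  proof (rule residue_cong[OF _ refl])
    have "eventually (\<lambda>z. z \<in> U - {p}) (at p)"
      using U by (intro eventually_at_in_open)
    then show "eventually (\<lambda>z. cot_factor \<mu> (\<alpha> * z - \<beta>) * G z =
                 ?c * (G z / (z - p) ^ Suc \<mu>) + A (\<alpha> * (z - p)) * G z) (at p)"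
    proof eventually_elim
      case (elim z)
      have "cot_factor \<mu> (\<alpha> * z - \<beta>) = cot_factor \<mu> (\<alpha> * (z - p) + (\<alpha> * p - \<beta>))"
        by (simp add: algebra_simps)
      also have "\<dots> = cot_factor \<mu> (\<alpha> * (z - p))"
        by (rule cot_factor_plus_int[OF p])
      also have "\<dots> = (-1) ^ \<mu> * fact \<mu> / (of_real pi * (\<alpha> * (z - p))) ^ Suc \<mu> + A (\<alpha> * (z - p))"
        using elim \<alpha> mem[of z] by (intro A(2)) auto
      also have "\<dots> = ?c / (z - p) ^ Suc \<mu> + A (\<alpha> * (z - p))"
        by (simp add: power_mult_distrib mult.assoc del: power_Suc)
      finally show ?case
        by (simp add: algebra_simps del: power_Suc)
    qed
  qed
  also have "\<dots> = residue (\<lambda>z. ?c * (G z / (z - p) ^ Suc \<mu>)) p + residue (\<lambda>z. A (\<alpha> * (z - p)) * G z) p"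
    by (rule residue_add[OF U(1,2)])
       (intro holomorphic_on_mult holomorphic_on_const quot holomorphic_on_subset[OF AG] Diff_subset)+
  also have "residue (\<lambda>z. A (\<alpha> * (z - p)) * G z) p = 0"
    by (rule residue_holo[OF U(1,2) AG])
  also have "residue (\<lambda>z. ?c * (G z / (z - p) ^ Suc \<mu>)) p = ?c * ((deriv ^^ \<mu>) G p / fact \<mu>)"
    by (subst residue_lmul[OF U(1,2) quot]) (subst residue_holomorphic_over_power[OF U(1,2) G_holo], rule refl)
  finally show ?thesis by simp
qed

section \<open>The residue theorem on a period strip\<close>

lemma contour_integral_linepath_shift:
  assumes "\<And>z. f (z + c) = f (z::complex)"
  shows "contour_integral (linepath (a + c) (b + c)) f = contour_integral (linepath a b) f"
proof -
  have "linepath (a + c) (b + c) x = linepath a b x + c" for x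
    by (simp add: linepath_def algebra_simps)
  then show ?thesis
    by (simp add: contour_integral_integral assms vector_derivative_linepath_within)
qed

text \<open>The segment runs from left to right over length 1, so the constant \<open>L\<close>
  integrates to \<open>L\<close>, and \<open>f - L\<close> is uniformly small on high segments.
  Beyond height \<open>Y\<close> no singularity obstructs integrability.\<close>

lemma tendsto_contour_integral_horizontal:
  assumes \<sigma>: "\<sigma> \<in> {1, -1::real}"
    and lim: "(f \<longlongrightarrow> L) (filtercomap (\<lambda>z. \<sigma> * Im z) at_top)"
    and cont: "\<And>y. \<sigma> * y > Y \<Longrightarrow> continuous_on {z. Im z = y} f"
  shows "((\<lambda>R. contour_integral (linepath (Complex x (\<sigma> * R)) (Complex (x + 1) (\<sigma> * R))) f) \<longlongrightarrow> L) at_top"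
proof (rule tendstoI)
  fix e :: real assume "e > 0"
  then have "eventually (\<lambda>z. dist (f z) L < e / 2) (filtercomap (\<lambda>z. \<sigma> * Im z) at_top)"
    by (intro tendstoD[OF lim]) auto
  then obtain N where N: "\<And>z. \<sigma> * Im z > N \<Longrightarrow> dist (f z) L < e / 2"
    by (auto simp: eventually_filtercomap_at_top_dense)
  show "eventually (\<lambda>R. dist (contour_integral (linepath (Complex x (\<sigma> * R)) (Complex (x + 1) (\<sigma> * R))) f) L < e) at_top"
    using eventually_gt_at_top[of "max N Y"]
  proof eventually_elim
    case (elim R)
    let ?a = "Complex x (\<sigma> * R)" and ?b = "Complex (x + 1) (\<sigma> * R)"
    have \<sigma>R: "\<sigma> * (\<sigma> * R) = R" using \<sigma> by auto
    have Im: "Im z = \<sigma> * R" if "z \<in> closed_segment ?a ?b" for z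
      using that closed_segment_same_Im[of ?a ?b] by simp
    have ba: "?b - ?a = 1" by (simp add: complex_eq_iff)
    have int: "f contour_integrable_on linepath ?a ?b"
      by (intro contour_integrable_continuous_linepath continuous_on_subset[OF cont[of "\<sigma> * R"]])
         (use elim in \<open>simp add: \<sigma>R\<close>, use Im in blast)
    have "contour_integral (linepath ?a ?b) (\<lambda>z. f z - L) = contour_integral (linepath ?a ?b) f - L"
      using int by (subst contour_integral_diff) (auto simp: contour_integral_const_linepath ba)
    moreover have "norm (contour_integral (linepath ?a ?b) (\<lambda>z. f z - L)) \<le> e / 2 * norm (?b - ?a)"
    proof (rule contour_integral_bound_linepath)
      show "(\<lambda>z. f z - L) contour_integrable_on linepath ?a ?b"
        by (intro contour_integrable_diff int contour_integrable_continuous_linepath continuous_intros)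
      fix z assume "z \<in> closed_segment ?a ?b"
      then show "norm (f z - L) \<le> e / 2"
        using N[of z] Im \<sigma>R elim by (simp add: dist_norm)
    qed (use \<open>e > 0\<close> in auto)
    ultimately show ?case
      using \<open>e > 0\<close> by (simp add: dist_norm ba)
  qed
qed

text \<open>The vertical sides of the rectangle cancel by periodicity, and the horizontal sides
  contribute the limits of the function at \<open>\<plusminus>\<i>\<infinity>\<close>.\<close>
lemma sum_residues_periodic_strip:
  fixes f :: "complex \<Rightarrow> complex" and L :: "real \<Rightarrow> complex"
  assumes holo: "f holomorphic_on - P"
    and per: "\<And>z. f (z + 1) = f z"
    and lim: "\<And>\<sigma>. \<sigma> \<in> {1, -1} \<Longrightarrow> (f \<longlongrightarrow> L \<sigma>) (filtercomap (\<lambda>z. \<sigma> * Im z) at_top)"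
    and fin: "finite (P \<inter> {z. x - 1 < Re z \<and> Re z < x + 2})"
    and bdd: "\<And>z. z \<in> P \<Longrightarrow> \<bar>Im z\<bar> \<le> Y"
    and avoid: "\<And>z. z \<in> P \<Longrightarrow> Re z \<noteq> x \<and> Re z \<noteq> x + 1"
  shows "2 * pi * \<i> * (\<Sum>p\<in>P \<inter> {z. x < Re z \<and> Re z < x + 1}. residue f p) = L (-1) - L 1"
proof -
  \<comment> \<open>\<open>S\<close> is an open connected neighbourhood of the closed strip, serving
    as the domain for the residue theorem. Only the poles in \<open>T\<close> will be
    encircled.\<close>
  define S where "S = {z. x - 1 < Re z \<and> Re z < x + 2}"
  define T where "T = {z. x < Re z \<and> Re z < x + 1}"
  let ?I = "\<lambda>\<sigma> R. contour_integral (linepath (Complex x (\<sigma> * R)) (Complex (x + 1) (\<sigma> * R))) f"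
  have cont: "continuous_on {z. Im z = y} f" if "\<sigma> * y > Y" "\<sigma> \<in> {1, -1::real}" for \<sigma> y
    by (rule continuous_on_subset[OF holomorphic_on_imp_continuous_on[OF holo]])
       (use that bdd in fastforce)
  have conv: "(?I \<sigma> \<longlongrightarrow> L \<sigma>) at_top" if "\<sigma> \<in> {1, -1}" for \<sigma>
    using that by (intro tendsto_contour_integral_horizontal[where Y = Y] lim cont)
  have S: "open S" "convex S"
  proof -
    have "S = {z. x - 1 < Re z} \<inter> {z. Re z < x + 2}" by (auto simp: S_def)
    then show "open S" "convex S"
      by (auto intro!: open_Int open_halfspace_Re_gt open_halfspace_Re_lt
          convex_Int convex_halfspace_Re_gt convex_halfspace_Re_lt)
  qed
  \<comment> \<open>Once \<open>R\<close> exceeds \<open>Y\<close>, the rectangle encloses every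
    pole in \<open>T\<close>, so the right-hand side is independent of \<open>R\<close>.\<close>
  have rect: "?I (-1) R - ?I 1 R = 2 * pi * \<i> * (\<Sum>p\<in>P \<inter> T. residue f p)" if R: "R > max Y 0" for R
  proof -
    let ?a = "Complex x (- R)" and ?b = "Complex (x + 1) (- R)"
      and ?c = "Complex (x + 1) R" and ?d = "Complex x R"
    let ?g = "rectpath ?a ?c"
    have img: "path_image ?g \<subseteq> S - P"
      using R avoid bdd by (subst path_image_rectpath) (force simp: S_def)+
    have parts: "path_image ?g = closed_segment ?a ?b \<union> closed_segment ?b ?c \<union> closed_segment ?c ?d \<union> closed_segment ?d ?a"
      by (simp add: rectpath_def Let_def path_image_join Un_assoc)
    have seg: "f contour_integrable_on linepath u v" if "closed_segment u v \<subseteq> path_image ?g" for u v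
      by (intro contour_integrable_continuous_linepath
            continuous_on_subset[OF holomorphic_on_imp_continuous_on[OF holo]])
         (use that img in auto)
    have ints: "f contour_integrable_on linepath ?a ?b" "f contour_integrable_on linepath ?b ?c"
      "f contour_integrable_on linepath ?c ?d" "f contour_integrable_on linepath ?d ?a"
      by (intro seg; simp add: parts; blast)+
    have "contour_integral ?g f =
            contour_integral (linepath ?a ?b) f + (contour_integral (linepath ?b ?c) f +
            (contour_integral (linepath ?c ?d) f + contour_integral (linepath ?d ?a) f))"
      using ints by (simp add: rectpath_def Let_def)
    moreover have "contour_integral (linepath ?b ?c) f = contour_integral (linepath ?a ?d) f"
      using contour_integral_linepath_shift[of f 1 ?a ?d, OF per] by (simp add: Complex_eq algebra_simps)
    moreover have "contour_integral (linepath ?d ?a) f = - contour_integral (linepath ?a ?d) f"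
      "contour_integral (linepath ?c ?d) f = - contour_integral (linepath ?d ?c) f"
      by (rule contour_integral_reverse_linepath,
          rule continuous_on_subset[OF holomorphic_on_imp_continuous_on[OF holo]],
          use img parts in blast)+
    ultimately have "contour_integral ?g f = ?I (-1) R - ?I 1 R"
      by simp
    moreover have "contour_integral ?g f =
        2 * pi * \<i> * (\<Sum>p\<in>P \<inter> S. winding_number ?g p * residue f p)"
    proof (rule Residue_theorem[OF S(1) convex_connected[OF S(2)]])
      show "finite (P \<inter> S)" using fin by (simp add: S_def)
      show "f holomorphic_on S - P \<inter> S"
        by (rule holomorphic_on_subset[OF holo]) auto
      show "\<forall>z. z \<notin> S \<longrightarrow> winding_number ?g z = 0"
        using R by (auto simp: S_def in_cbox_complex_iff intro!: winding_number_rectpath_outside)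
    qed (use img in auto)
    \<comment> \<open>Poles of \<open>S\<close> outside \<open>T\<close> are not on the lines
      bounding \<open>T\<close> by \<open>avoid\<close>. They lie outside the closed rectangle and
      have winding number 0; those in \<open>T\<close> have winding number 1.\<close>
    moreover have "(\<Sum>p\<in>P \<inter> S. winding_number ?g p * residue f p) = (\<Sum>p\<in>P \<inter> T. residue f p)"
    proof (rule sum.mono_neutral_cong_right)
      show "finite (P \<inter> S)" using fin by (simp add: S_def)
      show "P \<inter> T \<subseteq> P \<inter> S" by (auto simp: S_def T_def)
      show "\<forall>p\<in>P \<inter> S - P \<inter> T. winding_number ?g p * residue f p = 0"
      proof
        fix p assume "p \<in> P \<inter> S - P \<inter> T"
        then have "p \<notin> cbox ?a ?c"
          using avoid[of p] by (auto simp: T_def in_cbox_complex_iff)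
        then show "winding_number ?g p * residue f p = 0"
          using R by (subst winding_number_rectpath_outside) auto
      qed
      fix p assume p: "p \<in> P \<inter> T"
      then have "p \<in> box ?a ?c"
        using R bdd[of p] by (auto simp: T_def in_box_complex_iff)
      then show "winding_number ?g p * residue f p = residue f p"
        by (simp add: winding_number_rectpath)
    qed
    ultimately show ?thesis by simp
  qed
  have "((\<lambda>R. ?I (-1) R - ?I 1 R) \<longlongrightarrow> L (-1) - L 1) at_top"
    by (intro tendsto_diff conv) auto
  moreover have "eventually (\<lambda>R. ?I (-1) R - ?I 1 R = 2 * pi * \<i> * (\<Sum>p\<in>P \<inter> T. residue f p)) at_top"
    by (rule eventually_mono[OF eventually_gt_at_top rect])
  \<comment> \<open>A function constant in \<open>R\<close> equals its limit.\<close>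
  ultimately have "((\<lambda>R::real. 2 * pi * \<i> * (\<Sum>p\<in>P \<inter> T. residue f p)) \<longlongrightarrow> L (-1) - L 1) at_top"
    by (rule Lim_transform_eventually)
  from tendsto_unique[OF trivial_limit_at_top_linorder tendsto_const this]
  show ?thesis
    by (simp add: T_def)
qed

section \<open>From poles in a strip to residue classes\<close>

lemma finite_poles_strip:
  assumes "a > 0"
  shows "finite {p. of_nat a * p - w \<in> \<int> \<and> lo < Re p \<and> Re p < hi}"
proof (rule finite_subset)
  show "{p. of_nat a * p - w \<in> \<int> \<and> lo < Re p \<and> Re p < hi} \<subseteq>
    (\<lambda>q::int. (of_int q + w) / of_nat a) ` {\<lfloor>a * lo - Re w\<rfloor>..\<lceil>a * hi - Re w\<rceil>}"
  proof
    fix p assume "p \<in> {p. of_nat a * p - w \<in> \<int> \<and> lo < Re p \<and> Re p < hi}"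
    then obtain q :: int where q: "of_nat a * p - w = of_int q" and p: "lo < Re p" "Re p < hi"
      by (auto elim: Ints_cases)
    have p_eq: "p = (of_int q + w) / of_nat a"
      using assms by (simp add: q[symmetric])
    have "real_of_int q = a * Re p - Re w"
      using arg_cong[OF q, of Re] by simp
    moreover have "a * lo < a * Re p" "a * Re p < a * hi"
      using p assms by auto
    ultimately have "q \<in> {\<lfloor>a * lo - Re w\<rfloor>..\<lceil>a * hi - Re w\<rceil>}"
      by (auto simp: floor_le_iff le_ceiling_iff)
    with p_eq show "p \<in> (\<lambda>q::int. (of_int q + w) / of_nat a) ` {\<lfloor>a * lo - Re w\<rfloor>..\<lceil>a * hi - Re w\<rceil>}"
      by blast
  qed
qed auto

text \<open>The poles are \<open>(q + w) / a\<close> for integers \<open>q\<close>, and translating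
  a pole by an integer changes \<open>q\<close> by a multiple of \<open>a\<close>. Hence each
  residue class modulo \<open>a\<close> has exactly one pole in a strip of width 1 whose boundary
  contains none.\<close>

lemma sum_poles_strip:
  fixes g :: "complex \<Rightarrow> 'a::comm_monoid_add"
  assumes a: "a > 0" and per: "\<And>p k. g (p + of_int k) = g p"
    and avoid: "\<And>p k. of_nat a * p - w \<in> \<int> \<Longrightarrow> Re p \<noteq> x + of_int k"
  shows "(\<Sum>p | of_nat a * p - w \<in> \<int> \<and> x < Re p \<and> Re p < x + 1. g p) =
           (\<Sum>k\<in>{0..<a}. g ((of_nat k + w) / of_nat a))"
\<comment> \<open>The map \<open>i\<close> translates \<open>(k + w) / a\<close> into the strip by
  an integer; \<open>j\<close> recovers the index \<open>q\<close> of a pole and reduces it modulo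
  \<open>a\<close>.\<close>
proof (rule sum.reindex_bij_witness[where
      i = "\<lambda>k. (of_nat k + w) / of_nat a - of_int \<lfloor>Re ((of_nat k + w) / of_nat a) - x\<rfloor>" and
      j = "\<lambda>p. nat (\<lfloor>Re (of_nat a * p - w)\<rfloor> mod int a)"], goal_cases)
  case (1 p)
  then obtain q :: int where q: "of_nat a * p - w = of_int q" and p: "x < Re p" "Re p < x + 1"
    by (auto elim: Ints_cases)
  define k where "k = nat (q mod int a)"
  have "int k = q - int a * (q div int a)"
    using a by (simp add: k_def minus_mult_div_eq_mod)
  then have "of_nat k = (of_int (q - int a * (q div int a)) :: complex)"
    by (metis of_int_of_nat_eq)
  then have "(of_nat k + w) / of_nat a = p - of_int (q div int a)"
    using a by (simp add: q[symmetric] field_simps)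
  moreover have "\<lfloor>Re p - of_int (q div int a) - x\<rfloor> = - (q div int a)"
    using p by (intro floor_unique) auto
  ultimately show ?case
    by (simp add: q k_def[symmetric])
next
  case (2 p)
  then show ?case using a by (simp add: nat_less_iff)
next
  case (3 k)
  define r where "r = \<lfloor>Re ((of_nat k + w) / of_nat a) - x\<rfloor>"
  have "of_nat a * ((of_nat k + w) / of_nat a - of_int r) - w = of_int (int k + int a * (- r))"
    using a by (simp add: right_diff_distrib)
  then have "\<lfloor>Re (of_nat a * ((of_nat k + w) / of_nat a - of_int r) - w)\<rfloor> = int k + int a * (- r)"
    by (simp only: complex_Re_of_int floor_of_int)
  then show ?case
    unfolding r_def[symmetric] using 3 by (simp only: mod_mult_self2) simp
next
  case (4 k)
  define r where "r = \<lfloor>Re ((of_nat k + w) / of_nat a) - x\<rfloor>"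
  define p where "p = (of_nat k + w) / of_nat a - of_int r"
  have "of_nat a * p - w = of_int (int k + int a * (- r))"
    using a by (simp add: p_def right_diff_distrib)
  then have "of_nat a * p - w \<in> \<int>"
    by (metis Ints_of_int)
  \<comment> \<open>The floor only gives \<open>x \<le> Re p\<close>; \<open>avoid\<close> makes the
    inequality strict.\<close>
  moreover from avoid[OF this, of 0] have "Re p \<noteq> x" by simp
  moreover have "Re p \<ge> x" "Re p < x + 1"
    using floor_correct[of "Re ((of_nat k + w) / of_nat a) - x"]
    unfolding p_def r_def minus_complex.sel complex_Re_of_int by linarith+
  ultimately show ?case
    by (simp add: p_def r_def)
next
  case (5 p)
  then obtain q :: int where q: "of_nat a * p - w = of_int q"
    by (auto elim: Ints_cases)
  define k where "k = nat (q mod int a)"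
  have "int k = q - int a * (q div int a)"
    using a by (simp add: k_def minus_mult_div_eq_mod)
  then have "of_nat k = (of_int (q - int a * (q div int a)) :: complex)"
    by (metis of_int_of_nat_eq)
  then have "(of_nat k + w) / of_nat a = p + of_int (- (q div int a))"
    using a by (simp add: q[symmetric] field_simps)
  then show ?case
    by (simp add: q k_def[symmetric] per del: of_int_minus)
qed

section \<open>The reciprocity law\<close>

theorem theorem2:
  fixes d :: nat and a m :: "nat \<Rightarrow> nat" and z :: "nat \<Rightarrow> complex"
  assumes "\<forall>i\<in>{0..d}. a i > 0"
    and "\<forall>i\<in>{0..d}. \<forall>j\<in>{0..d}. i \<noteq> j \<longrightarrow>
           (\<forall>p q :: int. (of_int p + z i) / of_nat (a i) - (of_int q + z j) / of_nat (a j) \<notin> \<int>)"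
  shows "(\<Sum>n\<in>{0..d}. (-1) ^ m n * fact (m n) *
            (\<Sum>l \<in> tuples_with_sum ({0..d} - {n}) (m n).
               (\<Prod>j \<in> {0..d} - {n}. of_nat (a j) ^ l j / fact (l j)) *
               dedekind_cot_sum (a n, m n, z n)
                 (map (\<lambda>j. (a j, m j + l j, z j)) (filter (\<lambda>j. j \<noteq> n) [0..<d + 1]))))
         = (if (\<forall>i\<in>{0..d}. m i = 0) \<and> even d then (-1) ^ (d div 2) else 0)"
proof -
  let ?J = "\<lambda>n. {0..d} - {n}"
  define Pn where "Pn = (\<lambda>n. {p. of_nat (a n) * p - z n \<in> \<int>})"
  define P where "P = (\<Union>n\<in>{0..d}. Pn n)"
  define f where "f = (\<lambda>w. \<Prod>j\<in>{0..d}. cot_factor (m j) (of_nat (a j) * w - z j))"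
  \<comment> \<open>\<open>g n p / pi\<close> will be the residue of \<open>f\<close> at a pole
    \<open>p\<close> of the \<open>n\<close>-th factor. The principal part contributes
    \<open>pi ^ (m n + 1)\<close> to the denominator and the Leibniz rule \<open>pi ^ m n\<close> to
    the numerator, leaving one factor \<open>1 / pi\<close>.\<close>
  define g where "g = (\<lambda>n p. (-1) ^ m n * fact (m n) / of_nat (a n) ^ (m n + 1) *
      (\<Sum>l\<in>tuples_with_sum (?J n) (m n). (\<Prod>j\<in>?J n. of_nat (a j) ^ l j / fact (l j)) *
         (\<Prod>j\<in>?J n. cot_factor (m j + l j) (of_nat (a j) * p - z j))))"
  have a: "a n > 0" if "n \<le> d" for n
    using assms(1) that by auto
  have Pn_eq: "Pn n = range (\<lambda>q::int. (of_int q + z n) / of_nat (a n))" if "n \<le> d" for n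
  proof (intro equalityI subsetI)
    fix p assume "p \<in> Pn n"
    then obtain q :: int where "of_nat (a n) * p - z n = of_int q"
      by (auto simp: Pn_def elim: Ints_cases)
    then have "p = (of_int q + z n) / of_nat (a n)"
      using a[OF that] by (simp add: field_simps)
    then show "p \<in> range (\<lambda>q::int. (of_int q + z n) / of_nat (a n))" by blast
  qed (use a[OF that] in \<open>auto simp: Pn_def\<close>)
  \<comment> \<open>A common pole of two factors would make the difference in the hypothesis 0,
    which is an integer.\<close>
  have disj: "of_nat (a j) * p - z j \<notin> \<int>" if "p \<in> Pn n" "n \<le> d" "j \<le> d" "j \<noteq> n" for p n j
  proof
    assume "of_nat (a j) * p - z j \<in> \<int>"
    then have "p \<in> Pn j" by (simp add: Pn_def)
    with that obtain q r :: int
      where "p = (of_int q + z j) / of_nat (a j)" "p = (of_int r + z n) / of_nat (a n)"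
      by (auto simp: Pn_eq)
    then have "(of_int q + z j) / of_nat (a j) - (of_int r + z n) / of_nat (a n) = 0"
      by simp
    then show False
      using assms(2) that by (metis Ints_0 atLeastAtMost_iff le0)
  qed

  \<comment> \<open>\<open>?B\<close> collects all integer translates of the real parts of poles. It
    is countable, so some real \<open>x\<close> has no pole on any of the lines
    \<open>Re p = x + k\<close>.\<close>
  let ?B = "\<Union>n\<in>{0..d}. \<Union>k::int. (\<lambda>q::int. Re ((of_int q + z n) / of_nat (a n)) - of_int k) ` UNIV"
  have "countable ?B"
    by (intro countable_UN countable_image) auto
  then have "?B \<noteq> UNIV"
    using uncountable_UNIV_real by metis
  then obtain x where x: "x \<notin> ?B"
    by blast
  have avoid: "Re p \<noteq> x + of_int k" if p: "p \<in> Pn n" and n: "n \<le> d" for p n k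
  proof
    assume *: "Re p = x + of_int k"
    obtain q :: int where "p = (of_int q + z n) / of_nat (a n)"
      using p Pn_eq[OF n] by auto
    with * have "x = Re ((of_int q + z n) / of_nat (a n)) - of_int k" by simp
    with n have "x \<in> ?B" by (intro UN_I) auto
    with x show False by contradiction
  qed

  have per: "cot_factor \<mu> (of_nat b * (w + of_int k) - c) = cot_factor \<mu> (of_nat b * w - c)"
    for \<mu> b w k c
    using cot_factor_plus_int[of "of_nat b * of_int k" \<mu> "of_nat b * w - c"]
    by (simp add: algebra_simps)
  have g_per: "g n (p + of_int k) = g n p" for n p k
    by (simp add: g_def per)

  define L :: "real \<Rightarrow> complex" where "L = (\<lambda>\<sigma>. \<Prod>j\<in>{0..d}. if m j = 0 then - \<sigma> * \<i> else 0)"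
  have "2 * pi * \<i> * (\<Sum>p\<in>P \<inter> {z. x < Re z \<and> Re z < x + 1}. residue f p) = L (-1) - L 1"
  \<comment> \<open>The poles of the \<open>n\<close>-th factor all have imaginary part
    \<open>Im (z n) / a n\<close>; the sum of the absolute values bounds each of them.\<close>
  proof (rule sum_residues_periodic_strip[where Y = "\<Sum>n\<in>{0..d}. \<bar>Im (z n)\<bar> / a n"])
    have "f analytic_on - P"
      unfolding f_def
      by (subst analytic_on_analytic_at)
         (auto simp: P_def Pn_def intro!: analytic_on_prod cot_factor_analytic)
    then show "f holomorphic_on - P"
      by (rule analytic_imp_holomorphic)
    show "f (w + 1) = f w" for w
      unfolding f_def using per[of _ _ w 1] by simp
    show "(f \<longlongrightarrow> L \<sigma>) (filtercomap (\<lambda>z. \<sigma> * Im z) at_top)" if \<sigma>: "\<sigma> \<in> {1, -1}" for \<sigma>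
      unfolding f_def L_def
    proof (intro tendsto_prod filterlim_compose[OF tendsto_cot_factor[OF \<sigma>]])
      fix j assume "j \<in> {0..d}"
      then have "real (a j) > 0" using a by auto
      \<comment> \<open>Since \<open>a j\<close> is positive, the affine argument of the
        \<open>j\<close>-th factor goes to the same end of the strip as \<open>w\<close>.\<close>
      then have "filterlim (\<lambda>y. - (\<sigma> * Im (z j)) + real (a j) * y) at_top at_top"
        by real_asymp
      from filterlim_compose[OF this filterlim_filtercomap[of "\<lambda>z. \<sigma> * Im z"]]
      show "filterlim (\<lambda>w. of_nat (a j) * w - z j) (filtercomap (\<lambda>z. \<sigma> * Im z) at_top)
              (filtercomap (\<lambda>z. \<sigma> * Im z) at_top)"
        by (simp add: filterlim_filtercomap_iff o_def algebra_simps)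
    qed
    have "P \<inter> {z. x - 1 < Re z \<and> Re z < x + 2} =
        (\<Union>n\<in>{0..d}. {p. of_nat (a n) * p - z n \<in> \<int> \<and> x - 1 < Re p \<and> Re p < x + 2})"
      by (auto simp: P_def Pn_def)
    also have "finite \<dots>"
      using a by (intro finite_UN_I finite_poles_strip) auto
    finally show "finite (P \<inter> {z. x - 1 < Re z \<and> Re z < x + 2})" .
  next
    fix p assume "p \<in> P"
    then obtain n where n: "n \<le> d" "p \<in> Pn n" by (auto simp: P_def)
    from avoid[OF n(2,1), of 0] avoid[OF n(2,1), of 1] show "Re p \<noteq> x \<and> Re p \<noteq> x + 1"
      by simp
    obtain q :: int where "p = (of_int q + z n) / of_nat (a n)"
      using n Pn_eq[OF n(1)] by auto
    then have "\<bar>Im p\<bar> = \<bar>Im (z n)\<bar> / a n"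
      by (simp add: Im_divide_of_nat)
    also have "\<dots> \<le> (\<Sum>n\<in>{0..d}. \<bar>Im (z n)\<bar> / a n)"
      using n by (intro member_le_sum) auto
    finally show "\<bar>Im p\<bar> \<le> (\<Sum>n\<in>{0..d}. \<bar>Im (z n)\<bar> / a n)" .
  qed
  also have "(\<Sum>p\<in>P \<inter> {z. x < Re z \<and> Re z < x + 1}. residue f p) =
      (\<Sum>n\<in>{0..d}. \<Sum>p\<in>Pn n \<inter> {z. x < Re z \<and> Re z < x + 1}. residue f p)"
  proof -
    have "P \<inter> {z. x < Re z \<and> Re z < x + 1} = (\<Union>n\<in>{0..d}. Pn n \<inter> {z. x < Re z \<and> Re z < x + 1})"
      by (auto simp: P_def)
    also have "(\<Sum>p\<in>\<dots>. residue f p) = (\<Sum>n\<in>{0..d}. \<Sum>p\<in>Pn n \<inter> {z. x < Re z \<and> Re z < x + 1}. residue f p)"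
    proof (rule sum.UNION_disjoint)
      show "\<forall>n\<in>{0..d}. finite (Pn n \<inter> {z. x < Re z \<and> Re z < x + 1})"
        using finite_poles_strip[OF a] by (simp add: Pn_def Int_def)
      show "\<forall>i\<in>{0..d}. \<forall>j\<in>{0..d}. i \<noteq> j \<longrightarrow>
          (Pn i \<inter> {z. x < Re z \<and> Re z < x + 1}) \<inter> (Pn j \<inter> {z. x < Re z \<and> Re z < x + 1}) = {}"
        using disj by (fastforce simp: Pn_def)
    qed auto
    finally show ?thesis .
  qed
  also have "\<dots> = (\<Sum>n\<in>{0..d}. \<Sum>p\<in>Pn n \<inter> {z. x < Re z \<and> Re z < x + 1}. g n p / pi)"
  proof (intro sum.cong refl)
    fix n p assume n': "n \<in> {0..d}" and "p \<in> Pn n \<inter> {z. x < Re z \<and> Re z < x + 1}"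
    then have p: "p \<in> Pn n" and n: "n \<le> d" by auto
    let ?G = "\<lambda>w. \<Prod>j\<in>?J n. cot_factor (m j) (of_nat (a j) * w - z j)"
    have an: "\<And>j. j \<in> ?J n \<Longrightarrow> (\<lambda>w. cot_factor (m j) (of_nat (a j) * w - z j)) analytic_on {p}"
      using disj[OF p n] by (intro cot_factor_analytic) auto
    have "residue f p = residue (\<lambda>w. cot_factor (m n) (of_nat (a n) * w - z n) * ?G w) p"
      unfolding f_def using n' by (subst prod.remove[of _ n]) auto
    also have "\<dots> = (-1) ^ m n / (of_real pi * of_nat (a n)) ^ Suc (m n) * (deriv ^^ m n) ?G p"
      using a[OF n] p an by (intro residue_cot_factor_mult analytic_on_prod) (auto simp: Pn_def)
    also have "(deriv ^^ m n) ?G p = fact (m n) * (\<Sum>l\<in>tuples_with_sum (?J n) (m n).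
        \<Prod>j\<in>?J n. (deriv ^^ l j) (\<lambda>w. cot_factor (m j) (of_nat (a j) * w - z j)) p / fact (l j))"
      by (rule higher_deriv_prod) (use an in auto)
    also have "(\<Sum>l\<in>tuples_with_sum (?J n) (m n).
        \<Prod>j\<in>?J n. (deriv ^^ l j) (\<lambda>w. cot_factor (m j) (of_nat (a j) * w - z j)) p / fact (l j)) =
        of_real pi ^ m n * (\<Sum>l\<in>tuples_with_sum (?J n) (m n). (\<Prod>j\<in>?J n. of_nat (a j) ^ l j / fact (l j)) *
         (\<Prod>j\<in>?J n. cot_factor (m j + l j) (of_nat (a j) * p - z j)))"
      unfolding sum_distrib_left
    proof (intro sum.cong refl)
      fix l assume "l \<in> tuples_with_sum (?J n) (m n)"
      \<comment> \<open>The chain rule gives \<open>pi ^ l j\<close> for each \<open>j\<close>;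
        these multiply to \<open>pi ^ m n\<close> because the tuple has sum
        \<open>m n\<close>.\<close>
      then have "of_real pi ^ m n = (\<Prod>j\<in>?J n. (of_real pi :: complex) ^ l j)"
        by (auto simp: tuples_with_sum_def simp flip: power_sum)
      moreover have "(deriv ^^ l j) (\<lambda>w. cot_factor (m j) (of_nat (a j) * w - z j)) p / fact (l j) =
          of_real pi ^ l j * (of_nat (a j) ^ l j / fact (l j) * cot_factor (m j + l j) (of_nat (a j) * p - z j))"
        if "j \<in> ?J n" for j
        using disj[OF p n, of j] that by (subst higher_deriv_cot_factor) (auto simp: power_mult_distrib)
      ultimately show "(\<Prod>j\<in>?J n. (deriv ^^ l j) (\<lambda>w. cot_factor (m j) (of_nat (a j) * w - z j)) p / fact (l j)) =
          of_real pi ^ m n * ((\<Prod>j\<in>?J n. of_nat (a j) ^ l j / fact (l j)) *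
           (\<Prod>j\<in>?J n. cot_factor (m j + l j) (of_nat (a j) * p - z j)))"
        by (simp add: prod.distrib[symmetric])
    qed
    finally show "residue f p = g n p / pi"
      by (simp add: g_def power_mult_distrib field_simps)
  qed
  also have "\<dots> = (\<Sum>n\<in>{0..d}. \<Sum>k\<in>{0..<a n}. g n ((of_nat k + z n) / of_nat (a n)) / pi)"
  proof (intro sum.cong refl)
    fix n assume "n \<in> {0..d}"
    then have n: "n \<le> d" by simp
    have "Pn n \<inter> {z. x < Re z \<and> Re z < x + 1} =
        {p. of_nat (a n) * p - z n \<in> \<int> \<and> x < Re p \<and> Re p < x + 1}"
      by (auto simp: Pn_def)
    then show "(\<Sum>p\<in>Pn n \<inter> {z. x < Re z \<and> Re z < x + 1}. g n p / pi) =
        (\<Sum>k\<in>{0..<a n}. g n ((of_nat k + z n) / of_nat (a n)) / pi)"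
      using avoid[OF _ n] by (simp add: sum_poles_strip[OF a[OF n]] g_per Pn_def)
  qed
  also have "\<dots> = (\<Sum>n\<in>{0..d}. (-1) ^ m n * fact (m n) *
            (\<Sum>l \<in> tuples_with_sum (?J n) (m n).
               (\<Prod>j \<in> ?J n. of_nat (a j) ^ l j / fact (l j)) *
               dedekind_cot_sum (a n, m n, z n)
                 (map (\<lambda>j. (a j, m j + l j, z j)) (filter (\<lambda>j. j \<noteq> n) [0..<d + 1])))) / pi"
    (is "_ = ?S / _")
    unfolding sum_divide_distrib[of _ "{0..d}"]
  proof (intro sum.cong refl)
    fix n assume "n \<in> {0..d}"
    then have n: "n \<le> d" by simp
    let ?cols = "\<lambda>l. map (\<lambda>j. (a j, m j + l j, z j)) (filter (\<lambda>j. j \<noteq> n) [0..<d + 1])"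
    let ?q = "\<lambda>k. (of_nat k + z n) / of_nat (a n)"
    have q: "?q k \<in> Pn n" for k
      using a[OF n] by (simp add: Pn_def)
    have ded: "dedekind_cot_sum (a n, m n, z n) (?cols l) = 1 / of_nat (a n) ^ (m n + 1) *
        (\<Sum>k\<in>{0..<a n}. \<Prod>j\<in>?J n. cot_factor (m j + l j) (of_nat (a j) * ?q k - z j))" for l
    proof -
      have set: "set (filter (\<lambda>j. j \<noteq> n) [0..<d + 1]) = ?J n" by auto
      \<comment> \<open>No residue is excluded as singular: \<open>?q k\<close> is a pole of the
        \<open>n\<close>-th factor, hence by \<open>disj\<close> not of any other.\<close>
      have "{k \<in> {0..<a n}. \<forall>(b, \<mu>, w) \<in> set (?cols l). of_nat b * ?q k - w \<notin> \<int>} = {0..<a n}"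
        using disj[OF q n] by auto
      moreover have "(\<Prod>(b, \<mu>, w)\<leftarrow>?cols l. cot_factor \<mu> (of_nat b * ?q k - w)) =
          (\<Prod>j\<in>?J n. cot_factor (m j + l j) (of_nat (a j) * ?q k - z j))" for k
        unfolding set[symmetric] by (subst prod.distinct_set_conv_list) (simp_all add: o_def)
      ultimately show ?thesis
        by simp
    qed
    show "(\<Sum>k\<in>{0..<a n}. g n (?q k) / pi) = (-1) ^ m n * fact (m n) *
            (\<Sum>l \<in> tuples_with_sum (?J n) (m n).
               (\<Prod>j \<in> ?J n. of_nat (a j) ^ l j / fact (l j)) *
               dedekind_cot_sum (a n, m n, z n) (?cols l)) / pi"
      unfolding ded g_def sum_divide_distrib[symmetric] sum_distrib_left[symmetric]
      by (subst sum.swap) (simp add: sum_distrib_left mult_ac)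
  qed
  finally have "2 * pi * \<i> * (?S / pi) = L (-1) - L 1" .
  moreover have "2 * pi * \<i> * (s / pi) = 2 * \<i> * s" for s :: complex
    by simp
  moreover have "L (-1) - L 1 = 2 * \<i> * (if (\<forall>i\<in>{0..d}. m i = 0) \<and> even d then (-1) ^ (d div 2) else 0)"
  proof (cases "\<forall>i\<in>{0..d}. m i = 0")
    case True
    then have L: "L \<sigma> = (- \<sigma> * \<i>) ^ Suc d" for \<sigma>
      by (simp add: L_def)
    \<comment> \<open>The difference is \<open>\<i> ^ Suc d - (- \<i>) ^ Suc d\<close>. For even
      \<open>d\<close> the exponent is odd and the powers add up to twice
      \<open>\<i> * (-1) ^ (d div 2)\<close>; for odd \<open>d\<close> they cancel.\<close>
    show ?thesis
    proof (cases "even d")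
      case even: True
      then obtain c where "d = 2 * c" by (elim evenE)
      with True show ?thesis
        by (simp add: L power_mult)
    next
      case odd: False
      then obtain c where "d = 2 * c + 1" by (elim oddE)
      with True show ?thesis
        by (simp add: L power_mult)
    qed
  next
    case False
    then obtain i where i: "i \<in> {0..d}" "m i \<noteq> 0" by blast
    have "L \<sigma> = 0" for \<sigma>
      unfolding L_def by (rule prod_zero) (use i in \<open>auto intro!: bexI[of _ i]\<close>)
    with False show ?thesis by auto
  qed
  ultimately have "2 * \<i> * ?S = 2 * \<i> * (if (\<forall>i\<in>{0..d}. m i = 0) \<and> even d then (-1) ^ (d div 2) else 0)"
    by (simp only:)
  then show ?thesis
    by (simp only: mult_cancel_left) simp
qed

end
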